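(* Let $\mathcal{C}$ be a target–context category with intrinsic behaviors (behavior object $B$, shadow functor $\Phi$, behavioral preorder $\succeq$ on $\overline{B}=\Phi(B)$). If there is a morphism $F\colon C\otimes C\to B$ that is an $A$-complete parametrization of maps $C\to B$ for some object $A$, then every morphism $g\colon B\to B$ has a quasi-fixed point, i.e. there is a morphism $b$ with codomain $B$ such that $\overline{b}\succeq^{\rm im}\overline{g}\circ\overline{b}$.
   Context: $\mathcal{C}$ is a gs-monoidal category (symmetric monoidal with tensor $\otimes$, unit $I$, and commutative comonoids $\mathrm{copy}_A\colon A\to A\otimes A$, $\mathrm{del}_A\colon A\to I$ on every object, compatible with $\otimes$, $\mathrm{del}_I=\mathrm{id}_I$), all of whose morphisms $f\colon A\to X$ are normalized: $f\circ\mathrm{dom}(f)=f$ where $\mathrm{dom}(f)=(\mathrm{id}_A\otimes(\mathrm{del}_X\circ f))\circ\mathrm{copy}_A$. A morphism $f$ is functional if $\mathrm{copy}_X\circ f=(f\otimes f)\circ\mathrm{copy}_A$. $\mathbf{Rel}$ is the category of sets and relations (tensor = cartesian product, $\mathrm{copy}(a)=\{(a,a)\}$, $\mathrm{del}$ the full relation to a singleton). A lax gs-monoidal functor $\Phi\colon\mathcal{C}\to\mathbf{Rel}$ is a lax symmetric monoidal functor with structure maps $\psi_0,\psi_{A,B}$ such that $\Phi(\mathrm{copy}_A)=\psi_{A,A}\circ\mathrm{copy}_{\Phi A}$ and $\Phi(\mathrm{del}_A)=\psi_0\circ\mathrm{del}_{\Phi A}$. Write $\overline{X}=\Phi(X)$,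 $\overline f=\Phi(f)$. Imitation: for a preordered set $(X,\succeq)$ and relations $\nu,\mu\colon A\to X$, $\nu\succeq^{\rm im}\mu$ iff for every $a$ with $\mu(a)\neq\emptyset$ there exist functions $\mathrm{enh}\colon\mu(a)\to\nu(a)$ with $\mathrm{enh}(u)\succeq u$ for all $u$ and $\mathrm{deg}\colon\nu(a)\to\mu(a)$ with $v\succeq\mathrm{deg}(v)$ for all $v$. A target–context category with intrinsic behaviors consists of such $\mathcal{C}$, objects $T,C,B$, a morphism $\mathrm{eval}\colon T\otimes C\to B$ such that $\overline{\mathrm{eval}}$ is a function, a lax gs-monoidal functor $\Phi\colon\mathcal{C}\to\mathbf{Rel}$ and a preorder $\succeq$ on $\overline{B}$; the ambient relation on $\mathcal{C}(A,T\otimes C)$ is $f\succeq g$ iff $\overline{\mathrm{eval}}\circ\overline f\succeq^{\rm im}\overline{\mathrm{eval}}\circ\overline g$, and it is required that $f\sqsupseteq g$ (i.e. $f\circ\mathrm{dom}(g)=g$) implies $f\succeq g$ and $f\succeq g$ implies $f\circ h\succeq g\circ h$. A morphism $F\colon P\otimes C\to B$ is an $A$-complete parametrization of maps $C\to B$ if for every $f\colon A\otimes C\to B$ there is a functional $p_f\colon A\to P$ with $\overline{F\circ(p_f\otimes\mathrm{id}_C)}\succeq^{\rm im}\overline{f}$. *)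

theory Defs
  imports Main
begin

section \<open>Categories\<close>

text \<open>Categories have a carrier of objects and a carrier of arrows; the value of \<open>g \<cdot> f\<close> is
  only constrained when \<open>g\<close> and \<open>f\<close> are arrows with \<open>tgt f = src g\<close>.\<close>

record ('o, 'm) category =
  obj :: "'o set"
  arr :: "'m set"
  source :: "'m \<Rightarrow> 'o" ("src\<index>")
  target :: "'m \<Rightarrow> 'o" ("tgt\<index>")
  ident :: "'o \<Rightarrow> 'm" ("ide\<index>")
  cmp :: "'m \<Rightarrow> 'm \<Rightarrow> 'm" (infixr "\<cdot>\<index>" 55)

definition hom_set :: "('o, 'm, 'z) category_scheme \<Rightarrow> 'o \<Rightarrow> 'o \<Rightarrow> 'm set" ("hom\<index>") where
  "hom\<^bsub>CC\<^esub> A X = {f \<in> arr CC. src\<^bsub>CC\<^esub> f = A \<and> tgt\<^bsub>CC\<^esub> f = X}"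

definition inverse_arrows :: "('o, 'm, 'z) category_scheme \<Rightarrow> 'm \<Rightarrow> 'm \<Rightarrow> bool" where
  "inverse_arrows CC f g \<longleftrightarrow>
     f \<in> arr CC \<and> g \<in> hom\<^bsub>CC\<^esub> (tgt\<^bsub>CC\<^esub> f) (src\<^bsub>CC\<^esub> f) \<and>
     g \<cdot>\<^bsub>CC\<^esub> f = ide\<^bsub>CC\<^esub> (src\<^bsub>CC\<^esub> f) \<and> f \<cdot>\<^bsub>CC\<^esub> g = ide\<^bsub>CC\<^esub> (tgt\<^bsub>CC\<^esub> f)"

definition iso_arr :: "('o, 'm, 'z) category_scheme \<Rightarrow> 'm \<Rightarrow> bool" where
  "iso_arr CC f \<longleftrightarrow> (\<exists>g. inverse_arrows CC f g)"

definition inv_arr :: "('o, 'm, 'z) category_scheme \<Rightarrow> 'm \<Rightarrow> 'm" where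
  "inv_arr CC f = (THE g. inverse_arrows CC f g)"

locale category =
  fixes CC :: "('o, 'm, 'z) category_scheme" (structure)
  assumes src_obj: "f \<in> arr CC \<Longrightarrow> src f \<in> obj CC"
    and tgt_obj: "f \<in> arr CC \<Longrightarrow> tgt f \<in> obj CC"
    and ide_hom: "A \<in> obj CC \<Longrightarrow> ide A \<in> hom A A"
    and cmp_hom: "f \<in> hom X Y \<Longrightarrow> g \<in> hom Y Z \<Longrightarrow> g \<cdot> f \<in> hom X Z"
    and cmp_ide_left: "f \<in> hom X Y \<Longrightarrow> ide Y \<cdot> f = f"
    and cmp_ide_right: "f \<in> hom X Y \<Longrightarrow> f \<cdot> ide X = f"
    and cmp_assoc: "f \<in> hom W X \<Longrightarrow> g \<in> hom X Y \<Longrightarrow> h \<in> hom Y Z \<Longrightarrow>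
                      (h \<cdot> g) \<cdot> f = h \<cdot> (g \<cdot> f)"

section \<open>Symmetric monoidal categories\<close>

record ('o, 'm) monoidal_category = "('o, 'm) category" +
  ten_obj :: "'o \<Rightarrow> 'o \<Rightarrow> 'o" (infixr "\<otimes>\<index>" 70)
  ten_arr :: "'m \<Rightarrow> 'm \<Rightarrow> 'm" (infixr "\<boxtimes>\<index>" 70)
  unit_obj :: 'o ("\<one>\<index>")
  assoc :: "'o \<Rightarrow> 'o \<Rightarrow> 'o \<Rightarrow> 'm" ("\<alpha>\<index>")
  lunit :: "'o \<Rightarrow> 'm" ("\<lambda>\<^sub>l\<index>")
  runit :: "'o \<Rightarrow> 'm" ("\<rho>\<index>")

locale monoidal_category = category CC
  for CC :: "('o, 'm, 'z) monoidal_category_scheme" (structure) +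
  assumes unit_obj: "\<one> \<in> obj CC"
    and ten_obj: "A \<in> obj CC \<Longrightarrow> B \<in> obj CC \<Longrightarrow> A \<otimes> B \<in> obj CC"
    and ten_hom: "f \<in> hom A X \<Longrightarrow> g \<in> hom B Y \<Longrightarrow> f \<boxtimes> g \<in> hom (A \<otimes> B) (X \<otimes> Y)"
    and ten_ide: "A \<in> obj CC \<Longrightarrow> B \<in> obj CC \<Longrightarrow> ide A \<boxtimes> ide B = ide (A \<otimes> B)"
    and ten_cmp: "f \<in> hom A X \<Longrightarrow> f' \<in> hom X X' \<Longrightarrow> g \<in> hom B Y \<Longrightarrow> g' \<in> hom Y Y' \<Longrightarrow>
                    (f' \<cdot> f) \<boxtimes> (g' \<cdot> g) = (f' \<boxtimes> g') \<cdot> (f \<boxtimes> g)"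
    and assoc_hom: "A \<in> obj CC \<Longrightarrow> B \<in> obj CC \<Longrightarrow> C \<in> obj CC \<Longrightarrow>
                      \<alpha> A B C \<in> hom ((A \<otimes> B) \<otimes> C) (A \<otimes> (B \<otimes> C))"
    and assoc_iso: "A \<in> obj CC \<Longrightarrow> B \<in> obj CC \<Longrightarrow> C \<in> obj CC \<Longrightarrow> iso_arr CC (\<alpha> A B C)"
    and assoc_nat: "f \<in> hom A X \<Longrightarrow> g \<in> hom B Y \<Longrightarrow> h \<in> hom C Z \<Longrightarrow>
                      \<alpha> X Y Z \<cdot> ((f \<boxtimes> g) \<boxtimes> h) = (f \<boxtimes> (g \<boxtimes> h)) \<cdot> \<alpha> A B C"
    and lunit_hom: "A \<in> obj CC \<Longrightarrow> \<lambda>\<^sub>l A \<in> hom (\<one> \<otimes> A) A"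
    and lunit_iso: "A \<in> obj CC \<Longrightarrow> iso_arr CC (\<lambda>\<^sub>l A)"
    and lunit_nat: "f \<in> hom A X \<Longrightarrow> \<lambda>\<^sub>l X \<cdot> (ide \<one> \<boxtimes> f) = f \<cdot> \<lambda>\<^sub>l A"
    and runit_hom: "A \<in> obj CC \<Longrightarrow> \<rho> A \<in> hom (A \<otimes> \<one>) A"
    and runit_iso: "A \<in> obj CC \<Longrightarrow> iso_arr CC (\<rho> A)"
    and runit_nat: "f \<in> hom A X \<Longrightarrow> \<rho> X \<cdot> (f \<boxtimes> ide \<one>) = f \<cdot> \<rho> A"
    and pentagon: "A \<in> obj CC \<Longrightarrow> B \<in> obj CC \<Longrightarrow> C \<in> obj CC \<Longrightarrow> D \<in> obj CC \<Longrightarrow>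
                     (ide A \<boxtimes> \<alpha> B C D) \<cdot> (\<alpha> A (B \<otimes> C) D \<cdot> (\<alpha> A B C \<boxtimes> ide D)) =
                     \<alpha> A B (C \<otimes> D) \<cdot> \<alpha> (A \<otimes> B) C D"
    and triangle: "A \<in> obj CC \<Longrightarrow> B \<in> obj CC \<Longrightarrow>
                     (ide A \<boxtimes> \<lambda>\<^sub>l B) \<cdot> \<alpha> A \<one> B = \<rho> A \<boxtimes> ide B"

record ('o, 'm) symmetric_category = "('o, 'm) monoidal_category" +
  symm :: "'o \<Rightarrow> 'o \<Rightarrow> 'm" ("\<sigma>\<index>")

locale symmetric_monoidal_category = monoidal_category CC
  for CC :: "('o, 'm, 'z) symmetric_category_scheme" (structure) +
  assumes symm_hom: "A \<in> obj CC \<Longrightarrow> B \<in> obj CC \<Longrightarrow> \<sigma> A B \<in> hom (A \<otimes> B) (B \<otimes> A)"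
    and symm_nat: "f \<in> hom A X \<Longrightarrow> g \<in> hom B Y \<Longrightarrow>
                     \<sigma> X Y \<cdot> (f \<boxtimes> g) = (g \<boxtimes> f) \<cdot> \<sigma> A B"
    and symm_symm: "A \<in> obj CC \<Longrightarrow> B \<in> obj CC \<Longrightarrow> \<sigma> B A \<cdot> \<sigma> A B = ide (A \<otimes> B)"
    and hexagon: "A \<in> obj CC \<Longrightarrow> B \<in> obj CC \<Longrightarrow> C \<in> obj CC \<Longrightarrow>
                    \<alpha> B C A \<cdot> (\<sigma> A (B \<otimes> C) \<cdot> \<alpha> A B C) =
                    (ide B \<boxtimes> \<sigma> A C) \<cdot> (\<alpha> B A C \<cdot> (\<sigma> A B \<boxtimes> ide C))"

text \<open>The middle-four interchange \<open>(A \<otimes> B) \<otimes> (C \<otimes> D) \<rightarrow> (A \<otimes> C) \<otimes> (B \<otimes> D)\<close>, which in a strict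
  monoidal category is \<open>id \<otimes> \<sigma> \<otimes> id\<close>.\<close>

definition interchange ::
  "('o, 'm, 'z) symmetric_category_scheme \<Rightarrow> 'o \<Rightarrow> 'o \<Rightarrow> 'o \<Rightarrow> 'o \<Rightarrow> 'm" ("\<tau>\<index>") where
  "\<tau>\<^bsub>CC\<^esub> A B C D =
     inv_arr CC (\<alpha>\<^bsub>CC\<^esub> A C (B \<otimes>\<^bsub>CC\<^esub> D)) \<cdot>\<^bsub>CC\<^esub>
     (ide\<^bsub>CC\<^esub> A \<boxtimes>\<^bsub>CC\<^esub> (\<alpha>\<^bsub>CC\<^esub> C B D \<cdot>\<^bsub>CC\<^esub> (\<sigma>\<^bsub>CC\<^esub> B C \<boxtimes>\<^bsub>CC\<^esub> ide\<^bsub>CC\<^esub> D) \<cdot>\<^bsub>CC\<^esub> inv_arr CC (\<alpha>\<^bsub>CC\<^esub> B C D)))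
     \<cdot>\<^bsub>CC\<^esub> \<alpha>\<^bsub>CC\<^esub> A B (C \<otimes>\<^bsub>CC\<^esub> D)"

section \<open>Gs-monoidal categories\<close>

record ('o, 'm) gs_category = "('o, 'm) symmetric_category" +
  copy_arr :: "'o \<Rightarrow> 'm" ("copy\<index>")
  del_arr :: "'o \<Rightarrow> 'm" ("del\<index>")

locale gs_monoidal_category = symmetric_monoidal_category CC
  for CC :: "('o, 'm, 'z) gs_category_scheme" (structure) +
  assumes copy_hom: "A \<in> obj CC \<Longrightarrow> copy A \<in> hom A (A \<otimes> A)"
    and del_hom: "A \<in> obj CC \<Longrightarrow> del A \<in> hom A \<one>"
    and copy_coassoc: "A \<in> obj CC \<Longrightarrow>
          \<alpha> A A A \<cdot> ((copy A \<boxtimes> ide A) \<cdot> copy A) = (ide A \<boxtimes> copy A) \<cdot> copy A"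
    and copy_counit_left: "A \<in> obj CC \<Longrightarrow> \<lambda>\<^sub>l A \<cdot> ((del A \<boxtimes> ide A) \<cdot> copy A) = ide A"
    and copy_counit_right: "A \<in> obj CC \<Longrightarrow> \<rho> A \<cdot> ((ide A \<boxtimes> del A) \<cdot> copy A) = ide A"
    and copy_commute: "A \<in> obj CC \<Longrightarrow> \<sigma> A A \<cdot> copy A = copy A"
    and copy_ten: "A \<in> obj CC \<Longrightarrow> B \<in> obj CC \<Longrightarrow>
          copy (A \<otimes> B) = \<tau> A A B B \<cdot> (copy A \<boxtimes> copy B)"
    and del_ten: "A \<in> obj CC \<Longrightarrow> B \<in> obj CC \<Longrightarrow>
          del (A \<otimes> B) = \<lambda>\<^sub>l \<one> \<cdot> (del A \<boxtimes> del B)"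
    and del_unit: "del \<one> = ide \<one>"

text \<open>The domain \<open>dom(f) : A \<rightarrow> A\<close> of \<open>f : A \<rightarrow> X\<close>; the right unitor is implicit in the usual notation.\<close>

definition gs_dom :: "('o, 'm, 'z) gs_category_scheme \<Rightarrow> 'm \<Rightarrow> 'm" where
  "gs_dom CC f =
     \<rho>\<^bsub>CC\<^esub> (src\<^bsub>CC\<^esub> f) \<cdot>\<^bsub>CC\<^esub>
     (ide\<^bsub>CC\<^esub> (src\<^bsub>CC\<^esub> f) \<boxtimes>\<^bsub>CC\<^esub> (del\<^bsub>CC\<^esub> (tgt\<^bsub>CC\<^esub> f) \<cdot>\<^bsub>CC\<^esub> f)) \<cdot>\<^bsub>CC\<^esub> copy\<^bsub>CC\<^esub> (src\<^bsub>CC\<^esub> f)"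

definition normalized :: "('o, 'm, 'z) gs_category_scheme \<Rightarrow> 'm \<Rightarrow> bool" where
  "normalized CC f \<longleftrightarrow> f \<cdot>\<^bsub>CC\<^esub> gs_dom CC f = f"

definition functional :: "('o, 'm, 'z) gs_category_scheme \<Rightarrow> 'm \<Rightarrow> bool" where
  "functional CC f \<longleftrightarrow>
     copy\<^bsub>CC\<^esub> (tgt\<^bsub>CC\<^esub> f) \<cdot>\<^bsub>CC\<^esub> f = (f \<boxtimes>\<^bsub>CC\<^esub> f) \<cdot>\<^bsub>CC\<^esub> copy\<^bsub>CC\<^esub> (src\<^bsub>CC\<^esub> f)"

definition extends :: "('o, 'm, 'z) gs_category_scheme \<Rightarrow> 'm \<Rightarrow> 'm \<Rightarrow> bool" (infix "\<sqsupseteq>\<index>" 50) where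
  "f \<sqsupseteq>\<^bsub>CC\<^esub> g \<longleftrightarrow> f \<cdot>\<^bsub>CC\<^esub> gs_dom CC g = g"

locale normalized_gs_monoidal_category = gs_monoidal_category CC
  for CC :: "('o, 'm, 'z) gs_category_scheme" (structure) +
  assumes all_normalized: "f \<in> arr CC \<Longrightarrow> normalized CC f"

section \<open>Sets and relations\<close>

text \<open>A morphism \<open>A \<rightarrow> X\<close> of Rel is a subset of \<open>A \<times> X\<close>, and \<open>R `` {a}\<close> is the set \<open>R(a)\<close>.
  The tensor is the cartesian product and the unit is \<open>UNIV :: unit set\<close>. As the product changes
  the type of elements, the structure maps of Rel are polymorphic constants.\<close>

abbreviation rel_comp :: "('b \<times> 'c) set \<Rightarrow> ('a \<times> 'b) set \<Rightarrow> ('a \<times> 'c) set"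
    (infixr "\<circ>\<^sub>R" 75) where
  "S \<circ>\<^sub>R R \<equiv> R O S"

definition rel_ten :: "('a \<times> 'x) set \<Rightarrow> ('b \<times> 'y) set \<Rightarrow> (('a \<times> 'b) \<times> ('x \<times> 'y)) set"
    (infixr "\<otimes>\<^sub>R" 80) where
  "R \<otimes>\<^sub>R S = {((a, b), (x, y)) | a b x y. (a, x) \<in> R \<and> (b, y) \<in> S}"

definition rel_assoc :: "'a set \<Rightarrow> 'b set \<Rightarrow> 'c set \<Rightarrow> ((('a \<times> 'b) \<times> 'c) \<times> ('a \<times> ('b \<times> 'c))) set" where
  "rel_assoc A B C = {(((a, b), c), (a, (b, c))) | a b c. a \<in> A \<and> b \<in> B \<and> c \<in> C}"

definition rel_lunit :: "'a set \<Rightarrow> ((unit \<times> 'a) \<times> 'a) set" where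
  "rel_lunit A = {(((), a), a) | a. a \<in> A}"

definition rel_runit :: "'a set \<Rightarrow> (('a \<times> unit) \<times> 'a) set" where
  "rel_runit A = {((a, ()), a) | a. a \<in> A}"

definition rel_symm :: "'a set \<Rightarrow> 'b set \<Rightarrow> (('a \<times> 'b) \<times> ('b \<times> 'a)) set" where
  "rel_symm A B = {((a, b), (b, a)) | a b. a \<in> A \<and> b \<in> B}"

definition rel_copy :: "'a set \<Rightarrow> ('a \<times> ('a \<times> 'a)) set" where
  "rel_copy A = {(a, (a, a)) | a. a \<in> A}"

definition rel_del :: "'a set \<Rightarrow> ('a \<times> unit) set" where
  "rel_del A = A \<times> UNIV"

definition rel_function :: "'a set \<Rightarrow> 'x set \<Rightarrow> ('a \<times> 'x) set \<Rightarrow> bool" where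
  "rel_function A X R \<longleftrightarrow> R \<subseteq> A \<times> X \<and> (\<forall>a\<in>A. \<exists>!x. (a, x) \<in> R)"

section \<open>Lax gs-monoidal functors to Rel\<close>

record ('o, 'm, 'e) rel_functor =
  fobj :: "'o \<Rightarrow> 'e set"
  farr :: "'m \<Rightarrow> ('e \<times> 'e) set"
  fzero :: "(unit \<times> 'e) set"
  fmult :: "'o \<Rightarrow> 'o \<Rightarrow> (('e \<times> 'e) \<times> 'e) set"

locale lax_gs_monoidal_functor_to_Rel = gs_monoidal_category CC
  for CC :: "('o, 'm, 'z) gs_category_scheme" (structure)
    and \<Phi> :: "('o, 'm, 'e) rel_functor" +
  assumes farr_hom: "f \<in> hom A X \<Longrightarrow> farr \<Phi> f \<subseteq> fobj \<Phi> A \<times> fobj \<Phi> X"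
    and farr_ide: "A \<in> obj CC \<Longrightarrow> farr \<Phi> (ide A) = Id_on (fobj \<Phi> A)"
    and farr_cmp: "f \<in> hom X Y \<Longrightarrow> g \<in> hom Y Z \<Longrightarrow>
          farr \<Phi> (g \<cdot> f) = farr \<Phi> g \<circ>\<^sub>R farr \<Phi> f"
    and fzero_hom: "fzero \<Phi> \<subseteq> UNIV \<times> fobj \<Phi> \<one>"
    and fmult_hom: "A \<in> obj CC \<Longrightarrow> B \<in> obj CC \<Longrightarrow>
          fmult \<Phi> A B \<subseteq> (fobj \<Phi> A \<times> fobj \<Phi> B) \<times> fobj \<Phi> (A \<otimes> B)"
    and fmult_nat: "f \<in> hom A X \<Longrightarrow> g \<in> hom B Y \<Longrightarrow>
          fmult \<Phi> X Y \<circ>\<^sub>R (farr \<Phi> f \<otimes>\<^sub>R farr \<Phi> g) = farr \<Phi> (f \<boxtimes> g) \<circ>\<^sub>R fmult \<Phi> A B"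
    and fmult_assoc: "A \<in> obj CC \<Longrightarrow> B \<in> obj CC \<Longrightarrow> C \<in> obj CC \<Longrightarrow>
          farr \<Phi> (\<alpha> A B C) \<circ>\<^sub>R fmult \<Phi> (A \<otimes> B) C \<circ>\<^sub>R (fmult \<Phi> A B \<otimes>\<^sub>R Id_on (fobj \<Phi> C)) =
          fmult \<Phi> A (B \<otimes> C) \<circ>\<^sub>R (Id_on (fobj \<Phi> A) \<otimes>\<^sub>R fmult \<Phi> B C) \<circ>\<^sub>R
            rel_assoc (fobj \<Phi> A) (fobj \<Phi> B) (fobj \<Phi> C)"
    and fmult_lunit: "A \<in> obj CC \<Longrightarrow>
          farr \<Phi> (\<lambda>\<^sub>l A) \<circ>\<^sub>R fmult \<Phi> \<one> A \<circ>\<^sub>R (fzero \<Phi> \<otimes>\<^sub>R Id_on (fobj \<Phi> A)) =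
          rel_lunit (fobj \<Phi> A)"
    and fmult_runit: "A \<in> obj CC \<Longrightarrow>
          farr \<Phi> (\<rho> A) \<circ>\<^sub>R fmult \<Phi> A \<one> \<circ>\<^sub>R (Id_on (fobj \<Phi> A) \<otimes>\<^sub>R fzero \<Phi>) =
          rel_runit (fobj \<Phi> A)"
    and fmult_symm: "A \<in> obj CC \<Longrightarrow> B \<in> obj CC \<Longrightarrow>
          farr \<Phi> (\<sigma> A B) \<circ>\<^sub>R fmult \<Phi> A B = fmult \<Phi> B A \<circ>\<^sub>R rel_symm (fobj \<Phi> A) (fobj \<Phi> B)"
    and farr_copy: "A \<in> obj CC \<Longrightarrow>
          farr \<Phi> (copy A) = fmult \<Phi> A A \<circ>\<^sub>R rel_copy (fobj \<Phi> A)"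
    and farr_del: "A \<in> obj CC \<Longrightarrow> farr \<Phi> (del A) = fzero \<Phi> \<circ>\<^sub>R rel_del (fobj \<Phi> A)"

section \<open>Imitation and target--context categories\<close>

text \<open>A preorder is a set \<open>R\<close> of pairs, with \<open>(x, y) \<in> R\<close> standing for \<open>x \<succeq> y\<close>;
  \<open>imitates R \<nu> \<mu>\<close> stands for \<open>\<nu> \<succeq>\<^sup>i\<^sup>m \<mu>\<close>.\<close>

definition imitates :: "('x \<times> 'x) set \<Rightarrow> ('a \<times> 'x) set \<Rightarrow> ('a \<times> 'x) set \<Rightarrow> bool" where
  "imitates R \<nu> \<mu> \<longleftrightarrow>
     (\<forall>a. \<mu> `` {a} \<noteq> {} \<longrightarrow>
        (\<exists>enh. (\<forall>u \<in> \<mu> `` {a}. enh u \<in> \<nu> `` {a} \<and> (enh u, u) \<in> R)) \<and>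
        (\<exists>deg. (\<forall>v \<in> \<nu> `` {a}. deg v \<in> \<mu> `` {a} \<and> (v, deg v) \<in> R)))"

definition ambient :: "('o, 'm, 'e) rel_functor \<Rightarrow> 'm \<Rightarrow> ('e \<times> 'e) set \<Rightarrow> 'm \<Rightarrow> 'm \<Rightarrow> bool" where
  "ambient \<Phi> ev R f g \<longleftrightarrow> imitates R (farr \<Phi> ev \<circ>\<^sub>R farr \<Phi> f) (farr \<Phi> ev \<circ>\<^sub>R farr \<Phi> g)"

locale target_context_category_intrinsic =
  normalized_gs_monoidal_category CC + lax_gs_monoidal_functor_to_Rel CC \<Phi>
  for CC :: "('o, 'm, 'z) gs_category_scheme" (structure)
    and \<Phi> :: "('o, 'm, 'e) rel_functor" +
  fixes T C B :: 'o
    and ev :: 'm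
    and R :: "('e \<times> 'e) set"
  assumes T_obj: "T \<in> obj CC"
    and C_obj: "C \<in> obj CC"
    and B_obj: "B \<in> obj CC"
    and ev_hom: "ev \<in> hom (T \<otimes> C) B"
    and ev_function: "rel_function (fobj \<Phi> (T \<otimes> C)) (fobj \<Phi> B) (farr \<Phi> ev)"
    and behavioral_preorder: "preorder_on (fobj \<Phi> B) R"
    and ambient_extends: "f \<in> hom A (T \<otimes> C) \<Longrightarrow> g \<in> hom A (T \<otimes> C) \<Longrightarrow> f \<sqsupseteq> g \<Longrightarrow>
          ambient \<Phi> ev R f g"
    and ambient_precomp: "f \<in> hom A (T \<otimes> C) \<Longrightarrow> g \<in> hom A (T \<otimes> C) \<Longrightarrow> h \<in> hom A' A \<Longrightarrow>
          ambient \<Phi> ev R f g \<Longrightarrow> ambient \<Phi> ev R (f \<cdot> h) (g \<cdot> h)"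

text \<open>\<open>complete_parametrization CC \<Phi> R C B A P F\<close>: the arrow \<open>F : P \<otimes> C \<rightarrow> B\<close> is an
  \<open>A\<close>-complete parametrization of maps \<open>C \<rightarrow> B\<close>.\<close>

definition complete_parametrization ::
  "('o, 'm, 'z) gs_category_scheme \<Rightarrow> ('o, 'm, 'e) rel_functor \<Rightarrow> ('e \<times> 'e) set \<Rightarrow>
   'o \<Rightarrow> 'o \<Rightarrow> 'o \<Rightarrow> 'o \<Rightarrow> 'm \<Rightarrow> bool" where
  "complete_parametrization CC \<Phi> R C B A P F \<longleftrightarrow>
     F \<in> hom\<^bsub>CC\<^esub> (P \<otimes>\<^bsub>CC\<^esub> C) B \<and>
     (\<forall>f \<in> hom\<^bsub>CC\<^esub> (A \<otimes>\<^bsub>CC\<^esub> C) B. \<exists>p \<in> hom\<^bsub>CC\<^esub> A P. functional CC p \<and>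
        imitates R (farr \<Phi> (F \<cdot>\<^bsub>CC\<^esub> (p \<boxtimes>\<^bsub>CC\<^esub> ide\<^bsub>CC\<^esub> C))) (farr \<Phi> f))"

definition quasi_fixed_point ::
  "('o, 'm, 'z) gs_category_scheme \<Rightarrow> ('o, 'm, 'e) rel_functor \<Rightarrow> ('e \<times> 'e) set \<Rightarrow>
   'o \<Rightarrow> 'm \<Rightarrow> 'm \<Rightarrow> bool" where
  "quasi_fixed_point CC \<Phi> R B g b \<longleftrightarrow>
     b \<in> arr CC \<and> tgt\<^bsub>CC\<^esub> b = B \<and> imitates R (farr \<Phi> b) (farr \<Phi> g \<circ>\<^sub>R farr \<Phi> b)"

end

theory Submission
  imports Defs
begin

text \<open>This is Lawvere's diagonal argument. Let \<open>p : A \<rightarrow> C\<close> be functional such that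
  \<open>F \<circ> (p \<otimes> id)\<close> imitates \<open>f = g \<circ> F \<circ> copy \<circ> \<pi>\<close>, where \<open>\<pi> : A \<otimes> C \<rightarrow> C\<close> discards \<open>A\<close>.
  Precomposing with \<open>h = (id \<otimes> p) \<circ> copy\<close> yields \<open>b = F \<circ> copy \<circ> p\<close> on the left and \<open>g \<circ> b\<close> on
  the right. Imitation is not stable under precomposition with arbitrary relations, because some
  points of \<open>\<Phi> h\<close> over \<open>a\<close> may lie outside the domain of \<open>\<Phi> f\<close> while others do not. Here this
  cannot happen: \<open>\<Phi> p\<close> is single-valued, \<open>\<Phi> \<pi>\<close> is total and \<open>\<pi> \<circ> h = p\<close>, so \<open>\<Phi> f\<close> takes the same
  set of values at all points of \<open>\<Phi> h\<close> over \<open>a\<close>.\<close>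

section \<open>Imitation and precomposition\<close>

lemma imitates_precomp:
  assumes im: "imitates R \<nu> \<mu>"
    and const: "\<And>a w w'. (a, w) \<in> h \<Longrightarrow> (a, w') \<in> h \<Longrightarrow> \<mu> `` {w} = \<mu> `` {w'}"
  shows "imitates R (\<nu> \<circ>\<^sub>R h) (\<mu> \<circ>\<^sub>R h)"
  unfolding imitates_def
proof (intro allI impI)
  fix a
  assume "(\<mu> \<circ>\<^sub>R h) `` {a} \<noteq> {}"
  then obtain w\<^sub>0 u\<^sub>0 where w\<^sub>0: "(a, w\<^sub>0) \<in> h" "(w\<^sub>0, u\<^sub>0) \<in> \<mu>" by blast
  \<comment> \<open>By \<open>const\<close>, one point over \<open>a\<close> in the domain of \<mu>
    puts every point over \<open>a\<close> in that domain, so the imitation hypothesis applies at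
    each of them.\<close>
  have im_at: "(\<forall>u \<in> \<mu> `` {w}. \<exists>v \<in> \<nu> `` {w}. (v, u) \<in> R) \<and>
      (\<forall>v \<in> \<nu> `` {w}. \<exists>u \<in> \<mu> `` {w}. (v, u) \<in> R)" if "(a, w) \<in> h" for w
  proof -
    have "\<mu> `` {w} \<noteq> {}" using const[OF that w\<^sub>0(1)] w\<^sub>0(2) by blast
    with im show ?thesis unfolding imitates_def by blast
  qed
  \<comment> \<open>Functions belonging to different \<open>w\<close> may disagree on a shared
    value. Only existence is kept, and \<open>bchoice\<close> selects one function for the whole
    union.\<close>
  have "\<forall>u \<in> (\<mu> \<circ>\<^sub>R h) `` {a}. \<exists>v. v \<in> (\<nu> \<circ>\<^sub>R h) `` {a} \<and> (v, u) \<in> R"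
    using im_at by blast
  moreover have "\<forall>v \<in> (\<nu> \<circ>\<^sub>R h) `` {a}. \<exists>u. u \<in> (\<mu> \<circ>\<^sub>R h) `` {a} \<and> (v, u) \<in> R"
    using im_at by blast
  ultimately show "(\<exists>enh. \<forall>u \<in> (\<mu> \<circ>\<^sub>R h) `` {a}. enh u \<in> (\<nu> \<circ>\<^sub>R h) `` {a} \<and> (enh u, u) \<in> R) \<and>
      (\<exists>deg. \<forall>v \<in> (\<nu> \<circ>\<^sub>R h) `` {a}. deg v \<in> (\<mu> \<circ>\<^sub>R h) `` {a} \<and> (v, deg v) \<in> R)"
    by (intro conjI bchoice)
qed

lemma rel_ten_comp: "(S' \<otimes>\<^sub>R T') \<circ>\<^sub>R (S \<otimes>\<^sub>R T) = (S' \<circ>\<^sub>R S) \<otimes>\<^sub>R (T' \<circ>\<^sub>R T)"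
  unfolding rel_ten_def by blast

lemma Id_on_comp: "Id_on A \<circ>\<^sub>R Id_on A = Id_on A"
  by auto

lemma in_hom_iff: "f \<in> hom\<^bsub>CC\<^esub> A X \<longleftrightarrow> f \<in> arr CC \<and> src\<^bsub>CC\<^esub> f = A \<and> tgt\<^bsub>CC\<^esub> f = X"
  by (simp add: hom_set_def)

section \<open>Projections built from deletion\<close>

context gs_monoidal_category
begin

definition proj_left :: "'o \<Rightarrow> 'o \<Rightarrow> 'm" where
  "proj_left A C = \<rho> A \<cdot> (ide A \<boxtimes> del C)"

definition proj_right :: "'o \<Rightarrow> 'o \<Rightarrow> 'm" where
  "proj_right A C = \<lambda>\<^sub>l C \<cdot> (del A \<boxtimes> ide C)"

lemma proj_right_hom:
  assumes "A \<in> obj CC" "C \<in> obj CC"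
  shows "proj_right A C \<in> hom (A \<otimes> C) C"
  unfolding proj_right_def
  using assms by (intro cmp_hom[OF ten_hom[OF del_hom ide_hom] lunit_hom])

text \<open>Naturality of the unitor moves \<open>del C\<close> inside, where it merges with
  \<open>del A\<close> by interchange. This says that the projection is total, which a general arrow
  need not be.\<close>

lemma del_proj_right:
  assumes A: "A \<in> obj CC" and C: "C \<in> obj CC"
  shows "del C \<cdot> proj_right A C = del (A \<otimes> C)"
proof -
  note d = del_hom[OF A] del_hom[OF C]
  have "del C \<cdot> proj_right A C = (del C \<cdot> \<lambda>\<^sub>l C) \<cdot> (del A \<boxtimes> ide C)"
    unfolding proj_right_def
    by (rule cmp_assoc[OF ten_hom[OF d(1) ide_hom[OF C]] lunit_hom[OF C] d(2), symmetric])
  also have "\<dots> = (\<lambda>\<^sub>l \<one> \<cdot> (ide \<one> \<boxtimes> del C)) \<cdot> (del A \<boxtimes> ide C)"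
    by (simp add: lunit_nat[OF d(2)])
  also have "\<dots> = \<lambda>\<^sub>l \<one> \<cdot> ((ide \<one> \<boxtimes> del C) \<cdot> (del A \<boxtimes> ide C))"
    by (rule cmp_assoc[OF ten_hom[OF d(1) ide_hom[OF C]] ten_hom[OF ide_hom[OF unit_obj] d(2)]
          lunit_hom[OF unit_obj]])
  also have "(ide \<one> \<boxtimes> del C) \<cdot> (del A \<boxtimes> ide C) = del A \<boxtimes> del C"
    using ten_cmp[OF d(1) ide_hom[OF unit_obj] ide_hom[OF C] d(2)]
    by (simp add: cmp_ide_left[OF d(1)] cmp_ide_right[OF d(2)])
  finally show ?thesis by (simp add: del_ten[OF A C])
qed

text \<open>Discarding \<open>A\<close> slides past \<open>p\<close> by interchange, and naturality
  of the unitor pulls \<open>p\<close> out. What remains is a copy with one leg deleted, which the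
  counit law cancels.\<close>

lemma proj_right_graph:
  assumes p: "p \<in> hom A C" and A: "A \<in> obj CC" and C: "C \<in> obj CC"
  shows "proj_right A C \<cdot> ((ide A \<boxtimes> p) \<cdot> copy A) = p"
proof -
  note iA = ide_hom[OF A] and iC = ide_hom[OF C] and i1 = ide_hom[OF unit_obj]
    and d = del_hom[OF A] and c = copy_hom[OF A]
  have swap: "(del A \<boxtimes> ide C) \<cdot> (ide A \<boxtimes> p) = (ide \<one> \<boxtimes> p) \<cdot> (del A \<boxtimes> ide A)"
    using ten_cmp[OF iA d p iC] ten_cmp[OF d i1 iA p]
    by (simp add: cmp_ide_left[OF d] cmp_ide_right[OF d] cmp_ide_left[OF p] cmp_ide_right[OF p])
  have "proj_right A C \<cdot> ((ide A \<boxtimes> p) \<cdot> copy A)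
      = \<lambda>\<^sub>l C \<cdot> ((del A \<boxtimes> ide C) \<cdot> ((ide A \<boxtimes> p) \<cdot> copy A))"
    unfolding proj_right_def
    by (rule cmp_assoc[OF cmp_hom[OF c ten_hom[OF iA p]] ten_hom[OF d iC] lunit_hom[OF C]])
  also have "(del A \<boxtimes> ide C) \<cdot> ((ide A \<boxtimes> p) \<cdot> copy A)
      = (ide \<one> \<boxtimes> p) \<cdot> ((del A \<boxtimes> ide A) \<cdot> copy A)"
    using cmp_assoc[OF c ten_hom[OF iA p] ten_hom[OF d iC]]
      cmp_assoc[OF c ten_hom[OF d iA] ten_hom[OF i1 p]] swap by simp
  also have "\<lambda>\<^sub>l C \<cdot> \<dots> = (p \<cdot> \<lambda>\<^sub>l A) \<cdot> ((del A \<boxtimes> ide A) \<cdot> copy A)"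
    using cmp_assoc[OF cmp_hom[OF c ten_hom[OF d iA]] ten_hom[OF i1 p] lunit_hom[OF C]]
      lunit_nat[OF p] by simp
  also have "\<dots> = p \<cdot> (\<lambda>\<^sub>l A \<cdot> ((del A \<boxtimes> ide A) \<cdot> copy A))"
    by (rule cmp_assoc[OF cmp_hom[OF c ten_hom[OF d iA]] lunit_hom[OF A] p])
  finally show ?thesis by (simp add: copy_counit_left[OF A] cmp_ide_right[OF p])
qed

text \<open>Interchange puts \<open>p\<close> on both legs of the copy; functionality then trades
  the two uses of \<open>p\<close> for one use whose output is copied.\<close>

lemma functional_diagonal:
  assumes p: "p \<in> hom A C" and A: "A \<in> obj CC" and C: "C \<in> obj CC"
    and F: "F \<in> hom (C \<otimes> C) B" and fnl: "functional CC p"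
  shows "(F \<cdot> (p \<boxtimes> ide C)) \<cdot> ((ide A \<boxtimes> p) \<cdot> copy A) = F \<cdot> (copy C \<cdot> p)"
proof -
  note iA = ide_hom[OF A] and iC = ide_hom[OF C] and c = copy_hom[OF A]
  have "(p \<boxtimes> ide C) \<cdot> (ide A \<boxtimes> p) = p \<boxtimes> p"
    using ten_cmp[OF iA p p iC] by (simp add: cmp_ide_left[OF p] cmp_ide_right[OF p])
  then have "(p \<boxtimes> ide C) \<cdot> ((ide A \<boxtimes> p) \<cdot> copy A) = (p \<boxtimes> p) \<cdot> copy A"
    using cmp_assoc[OF c ten_hom[OF iA p] ten_hom[OF p iC]] by simp
  also have "\<dots> = copy C \<cdot> p"
    using fnl p by (simp add: functional_def in_hom_iff)
  finally show ?thesis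
    using cmp_assoc[OF cmp_hom[OF c ten_hom[OF iA p]] ten_hom[OF p iC] F] by simp
qed

end

section \<open>Shadows of projections and of functional arrows\<close>

context lax_gs_monoidal_functor_to_Rel
begin

text \<open>Naturality of \<open>fmult\<close> and unit coherence reduce the composite to deletion
  in Rel. Although \<open>fmult\<close> may be multivalued, its values at a pair thus retain the
  second component; the left projection recovers the first.\<close>

lemma farr_proj_right_fmult:
  assumes A: "A \<in> obj CC" and C: "C \<in> obj CC"
  shows "farr \<Phi> (proj_right A C) \<circ>\<^sub>R fmult \<Phi> A C =
    {((a, c), c) | a c. a \<in> fobj \<Phi> A \<and> c \<in> fobj \<Phi> C}"
proof -
  let ?I = "Id_on (fobj \<Phi> C)"
  note d = del_hom[OF A] and iC = ide_hom[OF C]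
  have "farr \<Phi> (proj_right A C) \<circ>\<^sub>R fmult \<Phi> A C =
      farr \<Phi> (\<lambda>\<^sub>l C) \<circ>\<^sub>R farr \<Phi> (del A \<boxtimes> ide C) \<circ>\<^sub>R fmult \<Phi> A C"
    by (simp add: proj_right_def farr_cmp[OF ten_hom[OF d iC] lunit_hom[OF C]] O_assoc)
  also have "\<dots> = farr \<Phi> (\<lambda>\<^sub>l C) \<circ>\<^sub>R fmult \<Phi> \<one> C \<circ>\<^sub>R (farr \<Phi> (del A) \<otimes>\<^sub>R ?I)"
    using fmult_nat[OF d iC] by (simp add: farr_ide[OF C])
  also have "farr \<Phi> (del A) \<otimes>\<^sub>R ?I = (fzero \<Phi> \<otimes>\<^sub>R ?I) \<circ>\<^sub>R (rel_del (fobj \<Phi> A) \<otimes>\<^sub>R ?I)"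
    by (simp only: farr_del[OF A] rel_ten_comp Id_on_comp)
  also have "farr \<Phi> (\<lambda>\<^sub>l C) \<circ>\<^sub>R fmult \<Phi> \<one> C \<circ>\<^sub>R \<dots> =
      rel_lunit (fobj \<Phi> C) \<circ>\<^sub>R (rel_del (fobj \<Phi> A) \<otimes>\<^sub>R ?I)"
    using fmult_lunit[OF C] by (metis O_assoc)
  also have "\<dots> = {((a, c), c) | a c. a \<in> fobj \<Phi> A \<and> c \<in> fobj \<Phi> C}"
    by (force simp: rel_lunit_def rel_del_def rel_ten_def)
  finally show ?thesis .
qed

lemma farr_proj_left_fmult:
  assumes A: "A \<in> obj CC" and C: "C \<in> obj CC"
  shows "farr \<Phi> (proj_left A C) \<circ>\<^sub>R fmult \<Phi> A C =
    {((a, c), a) | a c. a \<in> fobj \<Phi> A \<and> c \<in> fobj \<Phi> C}"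
proof -
  let ?I = "Id_on (fobj \<Phi> A)"
  note d = del_hom[OF C] and iA = ide_hom[OF A]
  have "farr \<Phi> (proj_left A C) \<circ>\<^sub>R fmult \<Phi> A C =
      farr \<Phi> (\<rho> A) \<circ>\<^sub>R farr \<Phi> (ide A \<boxtimes> del C) \<circ>\<^sub>R fmult \<Phi> A C"
    by (simp add: proj_left_def farr_cmp[OF ten_hom[OF iA d] runit_hom[OF A]] O_assoc)
  also have "\<dots> = farr \<Phi> (\<rho> A) \<circ>\<^sub>R fmult \<Phi> A \<one> \<circ>\<^sub>R (?I \<otimes>\<^sub>R farr \<Phi> (del C))"
    using fmult_nat[OF iA d] by (simp add: farr_ide[OF A])
  also have "?I \<otimes>\<^sub>R farr \<Phi> (del C) = (?I \<otimes>\<^sub>R fzero \<Phi>) \<circ>\<^sub>R (?I \<otimes>\<^sub>R rel_del (fobj \<Phi> C))"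
    by (simp only: farr_del[OF C] rel_ten_comp Id_on_comp)
  also have "farr \<Phi> (\<rho> A) \<circ>\<^sub>R fmult \<Phi> A \<one> \<circ>\<^sub>R \<dots> =
      rel_runit (fobj \<Phi> A) \<circ>\<^sub>R (?I \<otimes>\<^sub>R rel_del (fobj \<Phi> C))"
    using fmult_runit[OF A] by (metis O_assoc)
  also have "\<dots> = {((a, c), a) | a c. a \<in> fobj \<Phi> A \<and> c \<in> fobj \<Phi> C}"
    by (force simp: rel_runit_def rel_del_def rel_ten_def)
  finally show ?thesis .
qed

text \<open>Unit coherence relates \<open>((), w)\<close> to \<open>w\<close> along a path through
  \<open>fzero\<close>, so the mere presence of \<open>w\<close> forces \<open>fzero\<close> to have
  a value.\<close>

lemma farr_del_total:
  assumes A: "A \<in> obj CC" and w: "w \<in> fobj \<Phi> A"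
  shows "\<exists>e. (w, e) \<in> farr \<Phi> (del A)"
proof -
  have "(((), w), w) \<in> farr \<Phi> (\<lambda>\<^sub>l A) \<circ>\<^sub>R fmult \<Phi> \<one> A \<circ>\<^sub>R (fzero \<Phi> \<otimes>\<^sub>R Id_on (fobj \<Phi> A))"
    using w by (simp add: fmult_lunit[OF A] rel_lunit_def)
  then obtain e where "((), e) \<in> fzero \<Phi>"
    by (auto simp: rel_ten_def)
  then show ?thesis using w by (auto simp: farr_del[OF A] rel_del_def)
qed

text \<open>The shadow of deletion is total and factors through that of the projection, so the first
  factor must already have a value at \<open>w\<close>.\<close>

lemma farr_proj_right_total:
  assumes A: "A \<in> obj CC" and C: "C \<in> obj CC" and w: "w \<in> fobj \<Phi> (A \<otimes> C)"
  shows "\<exists>c. (w, c) \<in> farr \<Phi> (proj_right A C)"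
proof -
  obtain e where "(w, e) \<in> farr \<Phi> (del (A \<otimes> C))"
    using farr_del_total[OF ten_obj[OF A C] w] by blast
  then have "(w, e) \<in> farr \<Phi> (del C) \<circ>\<^sub>R farr \<Phi> (proj_right A C)"
    using farr_cmp[OF proj_right_hom[OF A C] del_hom[OF C]] by (simp add: del_proj_right[OF A C])
  then show ?thesis by blast
qed

text \<open>The image of \<open>copy \<circ> p = (p \<otimes> p) \<circ> copy\<close> only says that
  \<open>fmult\<close> maps \<open>\<Phi>(p)(a) \<times> \<Phi>(p)(a)\<close> and its diagonal to the same set; the projections
  recover the components.\<close>

lemma single_valued_farr_functional:
  assumes p: "p \<in> hom A C" and A: "A \<in> obj CC" and C: "C \<in> obj CC"
    and fnl: "functional CC p"
  shows "single_valued (farr \<Phi> p)"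
proof (rule single_valuedI)
  fix a x y
  assume ax: "(a, x) \<in> farr \<Phi> p" and ay: "(a, y) \<in> farr \<Phi> p"
  have mem: "a \<in> fobj \<Phi> A" "x \<in> fobj \<Phi> C" "y \<in> fobj \<Phi> C"
    using farr_hom[OF p] ax ay by auto
  \<comment> \<open>The point \<open>w\<close> over \<open>(x, y)\<close> is chosen to reach
    \<open>x\<close> on the left; totality then supplies a value on the right, necessarily
    \<open>y\<close>.\<close>
  have "((x, y), x) \<in> farr \<Phi> (proj_left C C) \<circ>\<^sub>R fmult \<Phi> C C"
    using mem by (simp add: farr_proj_left_fmult[OF C C])
  then obtain w where w: "((x, y), w) \<in> fmult \<Phi> C C" and wx: "(w, x) \<in> farr \<Phi> (proj_left C C)"
    by blast
  have "w \<in> fobj \<Phi> (C \<otimes> C)" using fmult_hom[OF C C] w by auto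
  then obtain y' where wy': "(w, y') \<in> farr \<Phi> (proj_right C C)"
    using farr_proj_right_total[OF C C] by blast
  then have "((x, y), y') \<in> farr \<Phi> (proj_right C C) \<circ>\<^sub>R fmult \<Phi> C C" using w by blast
  then have "y' = y" by (simp add: farr_proj_right_fmult[OF C C])
  \<comment> \<open>Functionality places the same \<open>w\<close> over a diagonal point
    \<open>(z, z)\<close> as well, and its two projections then force
    \<open>x = z = y\<close>.\<close>
  have "(a, w) \<in> fmult \<Phi> C C \<circ>\<^sub>R (farr \<Phi> p \<otimes>\<^sub>R farr \<Phi> p) \<circ>\<^sub>R rel_copy (fobj \<Phi> A)"
    using ax ay w mem unfolding rel_ten_def rel_copy_def by blast
  also have "\<dots> = farr \<Phi> ((p \<boxtimes> p) \<cdot> copy A)"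
    by (metis O_assoc farr_cmp[OF copy_hom[OF A] ten_hom[OF p p]] farr_copy[OF A] fmult_nat[OF p p])
  also have "\<dots> = farr \<Phi> (copy C \<cdot> p)"
    using fnl p by (simp add: functional_def in_hom_iff)
  also have "\<dots> = fmult \<Phi> C C \<circ>\<^sub>R rel_copy (fobj \<Phi> C) \<circ>\<^sub>R farr \<Phi> p"
    by (simp add: farr_cmp[OF p copy_hom[OF C]] farr_copy[OF C] O_assoc)
  finally obtain z where z: "((z, z), w) \<in> fmult \<Phi> C C"
    by (auto simp: rel_copy_def)
  have "((z, z), x) \<in> farr \<Phi> (proj_left C C) \<circ>\<^sub>R fmult \<Phi> C C" using z wx by blast
  then have "x = z" by (simp add: farr_proj_left_fmult[OF C C])
  moreover have "((z, z), y') \<in> farr \<Phi> (proj_right C C) \<circ>\<^sub>R fmult \<Phi> C C" using z wy' by blast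
  then have "y' = z" by (simp add: farr_proj_right_fmult[OF C C])
  ultimately show "x = y" using \<open>y' = y\<close> by simp
qed

section \<open>The diagonal argument\<close>

theorem quasi_fixed_point_of_complete_parametrization:
  assumes A: "A \<in> obj CC" and C: "C \<in> obj CC"
    and param: "complete_parametrization CC \<Phi> R C B A C F"
    and g: "g \<in> hom B B"
  shows "\<exists>b. quasi_fixed_point CC \<Phi> R B g b"
proof -
  have F: "F \<in> hom (C \<otimes> C) B" using param by (simp add: complete_parametrization_def)
  define k where "k = g \<cdot> (F \<cdot> copy C)"
  note Fc = cmp_hom[OF copy_hom[OF C] F]
  have k: "k \<in> hom C B" unfolding k_def by (rule cmp_hom[OF Fc g])
  note pr = proj_right_hom[OF A C]
  obtain p where p: "p \<in> hom A C" and fnl: "functional CC p"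
    and im: "imitates R (farr \<Phi> (F \<cdot> (p \<boxtimes> ide C))) (farr \<Phi> (k \<cdot> proj_right A C))"
    using param cmp_hom[OF pr k] unfolding complete_parametrization_def by blast
  define h where "h = (ide A \<boxtimes> p) \<cdot> copy A"
  have h: "h \<in> hom A (A \<otimes> C)"
    unfolding h_def by (rule cmp_hom[OF copy_hom[OF A] ten_hom[OF ide_hom[OF A] p]])
  have pr_h: "proj_right A C \<cdot> h = p"
    unfolding h_def by (rule proj_right_graph[OF p A C])
  define b where "b = F \<cdot> (copy C \<cdot> p)"
  have b: "b \<in> hom A B"
    unfolding b_def by (rule cmp_hom[OF cmp_hom[OF p copy_hom[OF C]] F])
  have b_eq: "farr \<Phi> (F \<cdot> (p \<boxtimes> ide C)) \<circ>\<^sub>R farr \<Phi> h = farr \<Phi> b"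
    using farr_cmp[OF h cmp_hom[OF ten_hom[OF p ide_hom[OF C]] F]]
      functional_diagonal[OF p A C F fnl] by (simp add: h_def b_def)
  have "k \<cdot> p = g \<cdot> b"
    using cmp_assoc[OF p Fc g] cmp_assoc[OF p copy_hom[OF C] F] by (simp add: k_def b_def)
  then have gb_eq: "farr \<Phi> (k \<cdot> proj_right A C) \<circ>\<^sub>R farr \<Phi> h = farr \<Phi> g \<circ>\<^sub>R farr \<Phi> b"
    using farr_cmp[OF h cmp_hom[OF pr k]] cmp_assoc[OF h pr k] farr_cmp[OF b g]
    by (simp add: pr_h)
  \<comment> \<open>Totality gives a value \<open>c\<close> of the projection at \<open>w\<close>.
    It is also a value of \<open>p\<close> at \<open>a\<close>, where there is at most one, so both
    sets are the same singleton.\<close>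
  have pr_val: "farr \<Phi> (proj_right A C) `` {w} = farr \<Phi> p `` {a}" if aw: "(a, w) \<in> farr \<Phi> h" for a w
  proof -
    have "w \<in> fobj \<Phi> (A \<otimes> C)" using farr_hom[OF h] aw by auto
    then obtain c where c: "(w, c) \<in> farr \<Phi> (proj_right A C)"
      using farr_proj_right_total[OF A C] by blast
    have "farr \<Phi> p = farr \<Phi> (proj_right A C) \<circ>\<^sub>R farr \<Phi> h"
      using farr_cmp[OF h pr] by (simp add: pr_h)
    then have "(a, x) \<in> farr \<Phi> p" if "(w, x) \<in> farr \<Phi> (proj_right A C)" for x
      using aw that by blast
    then show ?thesis
      using c single_valuedD[OF single_valued_farr_functional[OF p A C fnl]] by blast
  qed
  have "imitates R (farr \<Phi> b) (farr \<Phi> g \<circ>\<^sub>R farr \<Phi> b)"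
    \<comment> \<open>The first rewrite also expands \<open>b\<close> to the right of
      \<open>g\<close>, so \<open>gb_eq\<close> is expanded in the same way to match.\<close>
    unfolding b_eq[symmetric] gb_eq[unfolded b_eq[symmetric], symmetric]
  proof (rule imitates_precomp[OF im])
    fix a w w'
    assume "(a, w) \<in> farr \<Phi> h" "(a, w') \<in> farr \<Phi> h"
    then show "farr \<Phi> (k \<cdot> proj_right A C) `` {w} = farr \<Phi> (k \<cdot> proj_right A C) `` {w'}"
      by (simp add: farr_cmp[OF pr k] relcomp_Image pr_val)
  qed
  then show ?thesis
    using b by (auto simp: quasi_fixed_point_def in_hom_iff)
qed

end

theorem mainTheorem4:
  fixes CC :: "('o, 'm, 'z) gs_category_scheme"
    and \<Phi> :: "('o, 'm, 'e) rel_functor"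
    and T C B A :: 'o
    and ev F g :: 'm
    and R :: "('e \<times> 'e) set"
  assumes "target_context_category_intrinsic CC \<Phi> T C B ev R"
    and "A \<in> obj CC"
    and "F \<in> hom\<^bsub>CC\<^esub> (C \<otimes>\<^bsub>CC\<^esub> C) B"
    and "complete_parametrization CC \<Phi> R C B A C F"
    and "g \<in> hom\<^bsub>CC\<^esub> B B"
  shows "\<exists>b. quasi_fixed_point CC \<Phi> R B g b"
proof -
  interpret target_context_category_intrinsic CC \<Phi> T C B ev R by (fact assms(1))
  show ?thesis
    by (rule quasi_fixed_point_of_complete_parametrization[OF assms(2) C_obj assms(4,5)])
qed

end
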